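(* Let $k\ge 2$. The map $$\Phi_\iota:\mathcal P_k/SL_k(\mathbb Z)\to\mathbb{FR}_k,\qquad \gamma\mapsto\mathcal M=(m_{i\,j})_{i,j\in\mathbb Z},\qquad m_{i\,j}=\det(\gamma_i,\ldots,\gamma_{i+k-2},\gamma_j),$$ is a bijection between equivalence classes of paths and tame $SL_k$-tilings coming from (infinite) $SL_k$-friezes.
   Context: A path is a bi-infinite sequence $\gamma=(\gamma_i)_{i\in\mathbb Z}$ of column vectors $\gamma_i\in\mathbb Z^k$ such that for every $i\in\mathbb Z$ the matrix $(\gamma_i,\ldots,\gamma_{i+k-1})$ lies in $SL_k(\mathbb Z)$; $\mathcal P_k$ is the set of all paths, and $SL_k(\mathbb Z)$ acts on it by $A\gamma=(A\gamma_i)_{i\in\mathbb Z}$. An $SL_k$-tiling is an integer array $(m_{i\,j})_{i,j\in\mathbb Z}$ all of whose adjacent $k\times k$ submatrices have determinant $1$; it is tame if all adjacent $(k+1)\times(k+1)$ submatrices have determinant $0$. An infinite $SL_k$-frieze $F$ is an array of offset bi-infinite rows of integers, with $k-1$ rows of zeros at the top, then a row of ones, then infinitely many further rows of integers, such that every $k\times k$ diamond of neighbouring entries has determinant $1$ and every $(k+1)\times(k+1)$ diamond has determinant $0$. In coordinates: $F=(f_{i\,j})_{i\in\mathbb Z,\,j\ge i}$, where the $t$-th row of the frieze consists of the entries $f_{i,\,i+t-1}$ ($i\in\mathbb Z$), so $f_{i\,j}=0$ for $i\le j\le i+k-2$, $f_{i,\,i+k-1}=1$, and the diamonds are the adjacent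 square submatrices lying entirely in the region $j\ge i$. (A finite $SL_k$-frieze, which has bottom rows of ones and zeros symmetric to the top ones, extends to an infinite one with the same tiling, so it is included here.) The tiling $\mathcal M_F$ of an infinite frieze $F$ is the unique tame $SL_k$-tiling with $m_{i\,j}=f_{i\,j}$ for all $j\ge i$ (the part $j\ge i$ determines all row and column recurrences and hence the rest of the tiling). $\mathbb{FR}_k$ is the set of all tilings $\mathcal M_F$ with $F$ an infinite $SL_k$-frieze. *)

theory Defs
  imports "Jordan_Normal_Form.Determinant"
begin

definition SL :: "nat \<Rightarrow> int mat set" where
  "SL k = {A \<in> carrier_mat k k. det A = 1}"

definition paths :: "nat \<Rightarrow> (int \<Rightarrow> int vec) set" where
  "paths k = {\<gamma>. (\<forall>i. \<gamma> i \<in> carrier_vec k) \<and>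
     (\<forall>i. mat_of_cols k (map (\<lambda>l. \<gamma> (i + int l)) [0..<k]) \<in> SL k)}"

definition path_act :: "int mat \<Rightarrow> (int \<Rightarrow> int vec) \<Rightarrow> int \<Rightarrow> int vec" where
  "path_act A \<gamma> = (\<lambda>i. A *\<^sub>v \<gamma> i)"

definition path_rel :: "nat \<Rightarrow> ((int \<Rightarrow> int vec) \<times> (int \<Rightarrow> int vec)) set" where
  "path_rel k = {(\<gamma>, \<delta>). \<gamma> \<in> paths k \<and> \<delta> \<in> paths k \<and> (\<exists>A \<in> SL k. \<delta> = path_act A \<gamma>)}"

definition adj_submatrix :: "nat \<Rightarrow> (int \<Rightarrow> int \<Rightarrow> int) \<Rightarrow> int \<Rightarrow> int \<Rightarrow> int mat" where
  "adj_submatrix n m i j = mat n n (\<lambda>(a, b). m (i + int a) (j + int b))"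

definition SL_tiling :: "nat \<Rightarrow> (int \<Rightarrow> int \<Rightarrow> int) \<Rightarrow> bool" where
  "SL_tiling k m \<longleftrightarrow> (\<forall>i j. det (adj_submatrix k m i j) = 1)"

definition tame :: "nat \<Rightarrow> (int \<Rightarrow> int \<Rightarrow> int) \<Rightarrow> bool" where
  "tame k m \<longleftrightarrow> (\<forall>i j. det (adj_submatrix (k + 1) m i j) = 0)"

text \<open>A frieze is an array $f_{i\,j}$ with $j \ge i$. The values of \<open>f\<close> at arguments with
  \<open>j < i\<close> are arbitrary and are never used. The adjacent $n \times n$ submatrix at $(i, j)$ is a
  diamond of the frieze iff its lower left entry, at $(i + n - 1, j)$, lies in the region.\<close>

definition friezes :: "nat \<Rightarrow> (int \<Rightarrow> int \<Rightarrow> int) set" where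
  "friezes k = {f.
     (\<forall>i j. i \<le> j \<and> j \<le> i + int k - 2 \<longrightarrow> f i j = 0) \<and>
     (\<forall>i. f i (i + int k - 1) = 1) \<and>
     (\<forall>i j. i + int k - 1 \<le> j \<longrightarrow> det (adj_submatrix k f i j) = 1) \<and>
     (\<forall>i j. i + int k \<le> j \<longrightarrow> det (adj_submatrix (k + 1) f i j) = 0)}"

definition frieze_tiling :: "nat \<Rightarrow> (int \<Rightarrow> int \<Rightarrow> int) \<Rightarrow> int \<Rightarrow> int \<Rightarrow> int" where
  "frieze_tiling k f = (THE m. SL_tiling k m \<and> tame k m \<and> (\<forall>i j. i \<le> j \<longrightarrow> m i j = f i j))"

definition FR :: "nat \<Rightarrow> (int \<Rightarrow> int \<Rightarrow> int) set" where
  "FR k = frieze_tiling k ` friezes k"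

definition path_tiling :: "nat \<Rightarrow> (int \<Rightarrow> int vec) \<Rightarrow> int \<Rightarrow> int \<Rightarrow> int" where
  "path_tiling k \<gamma> i j =
     det (mat_of_cols k (map (\<lambda>l. \<gamma> (i + int l)) [0..<k - 1] @ [\<gamma> j]))"

text \<open>The map induced on a class of paths: the common value of \<open>path_tiling k\<close> on its elements.\<close>

definition Phi :: "nat \<Rightarrow> (int \<Rightarrow> int vec) set \<Rightarrow> int \<Rightarrow> int \<Rightarrow> int" where
  "Phi k C = the_elem (path_tiling k ` C)"

lemma SL_inverse:
  assumes "A \<in> SL k"
  obtains B where "B \<in> SL k" "B * A = 1\<^sub>m k"
proof -
  have A: "A \<in> carrier_mat k k" "det A = 1"
    using assms by (auto simp: SL_def)
  have B: "adj_mat A \<in> carrier_mat k k" "adj_mat A * A = 1\<^sub>m k"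
    using adj_mat[OF A(1)] A(2) by auto
  have "det (adj_mat A) * det A = 1"
    using det_mult[OF B(1) A(1)] B(2) by simp
  then show ?thesis
    using that B A(2) by (auto simp: SL_def)
qed

lemma equiv_path_rel: "equiv (paths k) (path_rel k)"
proof (rule equivI)
  show "path_rel k \<subseteq> paths k \<times> paths k"
    by (auto simp: path_rel_def)
  show "refl_on (paths k) (path_rel k)"
  proof (rule refl_onI)
    fix \<gamma> assume g: "\<gamma> \<in> paths k"
    then have "\<gamma> = path_act (1\<^sub>m k) \<gamma>"
      by (auto simp: paths_def path_act_def)
    then have "\<exists>A \<in> SL k. \<gamma> = path_act A \<gamma>"
      by (rule bexI) (auto simp: SL_def)
    then show "(\<gamma>, \<gamma>) \<in> path_rel k"
      using g by (simp add: path_rel_def)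
  qed
  show "sym (path_rel k)"
  proof (rule symI)
    fix \<gamma> \<delta> assume r: "(\<gamma>, \<delta>) \<in> path_rel k"
    then obtain A where A: "A \<in> SL k" "\<delta> = path_act A \<gamma>"
      by (auto simp: path_rel_def)
    obtain B where B: "B \<in> SL k" "B * A = 1\<^sub>m k"
      using SL_inverse[OF A(1)] .
    have "B *\<^sub>v (A *\<^sub>v \<gamma> i) = \<gamma> i" for i
    proof -
      have c: "\<gamma> i \<in> carrier_vec k"
        using r by (auto simp: path_rel_def paths_def)
      have "B *\<^sub>v (A *\<^sub>v \<gamma> i) = (B * A) *\<^sub>v \<gamma> i"
        using A(1) B(1) c by (intro assoc_mult_mat_vec[symmetric]) (auto simp: SL_def)
      then show ?thesis
        using B(2) c by simp
    qed
    then have "\<gamma> = path_act B \<delta>"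
      using A(2) by (auto simp: path_act_def)
    then have "\<exists>B \<in> SL k. \<gamma> = path_act B \<delta>"
      by (rule bexI) (rule B(1))
    then show "(\<delta>, \<gamma>) \<in> path_rel k"
      using r by (simp add: path_rel_def)
  qed
  show "trans (path_rel k)"
  proof (rule transI)
    fix \<gamma> \<delta> \<epsilon> assume r: "(\<gamma>, \<delta>) \<in> path_rel k" "(\<delta>, \<epsilon>) \<in> path_rel k"
    then obtain A B where AB: "A \<in> SL k" "\<delta> = path_act A \<gamma>" "B \<in> SL k" "\<epsilon> = path_act B \<delta>"
      by (auto simp: path_rel_def)
    have "B *\<^sub>v (A *\<^sub>v \<gamma> i) = (B * A) *\<^sub>v \<gamma> i" for i
      using AB r by (intro assoc_mult_mat_vec[symmetric]) (auto simp: SL_def path_rel_def paths_def)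
    then have "\<epsilon> = path_act (B * A) \<gamma>"
      using AB by (auto simp: path_act_def)
    moreover have "B * A \<in> SL k"
      using AB(1,3) det_mult[of B k A] by (auto simp: SL_def)
    ultimately have "\<exists>C \<in> SL k. \<epsilon> = path_act C \<gamma>"
      by (rule bexI)
    then show "(\<gamma>, \<epsilon>) \<in> path_rel k"
      using r by (simp add: path_rel_def)
  qed
qed

end

theory Submission imports Defs begin

text \<open>The key point is that, in a tame $SL_k$-array, the column vectors formed by the entries in
  rows $i+1, \dots, i+k$ arise from those in rows $i, \dots, i+k-1$ by one matrix
  $B_i \in SL_k(\mathbb Z)$ that does not depend on the column. In a frieze this holds for the columns
  $j \ge i + k$, which already determine $B_i$; hence a tame tiling is determined by its part
  $j \ge i$. Undoing the $B_i$ turns the columns of a frieze, read off at any sufficiently small $i$,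
  into a path, and the triangular shape of the top rows identifies its tiling with the frieze.
  Conversely $m_{i\,j}$ is linear in $\gamma_j$, so the tiling of a path factors through
  $\mathbb Z^k$ with $SL_k$-factors. This makes it a tame $SL_k$-tiling, and it recovers the path up to
  a matrix in $SL_k(\mathbb Z)$.\<close>

section \<open>Matrices\<close>

text \<open>A kernel vector \<open>u\<close> of the large singular matrix has \<open>u $ n\<close>
  nonzero, since otherwise its first \<open>n\<close> entries would form a kernel vector of the
  regular corner. So \<open>u\<close> expresses the last column through the others up to a nonzero
  factor, and a relation \<open>x\<close> among the rows passes on to it.\<close>

lemma det_zero_last_column:
  fixes g :: "nat \<Rightarrow> nat \<Rightarrow> 'a :: idom"
  assumes P: "det (mat n n (\<lambda>(a, b). g a b)) \<noteq> 0"
    and M: "det (mat (Suc n) (Suc n) (\<lambda>(a, b). g a b)) = 0"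
    and x: "\<And>b. b < n \<Longrightarrow> (\<Sum>a<Suc n. x a * g a b) = 0"
  shows "(\<Sum>a<Suc n. x a * g a n) = 0"
proof -
  obtain u where u: "u \<in> carrier_vec (Suc n)" "u \<noteq> 0\<^sub>v (Suc n)"
    and Mu: "mat (Suc n) (Suc n) (\<lambda>(a, b). g a b) *\<^sub>v u = 0\<^sub>v (Suc n)"
    using M det_0_iff_vec_prod_zero[of "mat (Suc n) (Suc n) (\<lambda>(a, b). g a b)" "Suc n"] by auto
  have row: "(\<Sum>b<Suc n. g a b * u $ b) = 0" if "a < Suc n" for a
    using arg_cong[OF Mu, of "\<lambda>v. v $ a"] that u(1)
    by (simp add: mult_mat_vec_def scalar_prod_def atLeast0LessThan del: sum.lessThan_Suc)
  have "u $ n \<noteq> 0"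
  proof
    assume un: "u $ n = 0"
    define v where "v = vec n (\<lambda>b. u $ b)"
    have "mat n n (\<lambda>(a, b). g a b) *\<^sub>v v = 0\<^sub>v n"
    proof (rule eq_vecI)
      fix a assume "a < dim_vec (0\<^sub>v n :: 'a vec)"
      then show "(mat n n (\<lambda>(a, b). g a b) *\<^sub>v v) $ a = 0\<^sub>v n $ a"
        using row[of a] un by (simp add: v_def mult_mat_vec_def scalar_prod_def atLeast0LessThan)
    qed simp
    moreover have "v \<in> carrier_vec n"
      by (simp add: v_def)
    ultimately have v0: "v = 0\<^sub>v n"
      using P det_0_iff_vec_prod_zero[of "mat n n (\<lambda>(a, b). g a b)" n] by (metis mat_carrier)
    have "u $ b = 0" if "b < Suc n" for b
      using un that arg_cong[OF v0, of "\<lambda>w. w $ b"] by (cases "b = n") (auto simp: v_def)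
    then show False
      using u by (auto intro!: eq_vecI)
  qed
  \<comment> \<open>Evaluate the product of \<open>x\<close>, the matrix and \<open>u\<close> in two
    ways: by rows it is 0, and by columns only the last one can contribute.\<close>
  moreover have "(\<Sum>a<Suc n. x a * g a n) * u $ n = 0"
  proof -
    have "(\<Sum>b<Suc n. (\<Sum>a<Suc n. x a * g a b) * u $ b) = (\<Sum>a<Suc n. x a * (\<Sum>b<Suc n. g a b * u $ b))"
      unfolding sum_distrib_left sum_distrib_right by (subst sum.swap) (simp only: mult.assoc)
    also have "\<dots> = 0"
      using row by (simp del: sum.lessThan_Suc)
    moreover have "(\<Sum>b<n. (\<Sum>a<Suc n. x a * g a b) * u $ b) = 0"
      using x by (simp del: sum.lessThan_Suc)
    ultimately show ?thesis
      by (simp only: sum.lessThan_Suc[of _ n]) simp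
  qed
  ultimately show ?thesis
    by simp
qed

lemma SL_carrier: "A \<in> SL k \<Longrightarrow> A \<in> carrier_mat k k"
  by (simp add: SL_def)

lemma SL_det: "A \<in> SL k \<Longrightarrow> det A = 1"
  by (simp add: SL_def)

lemma SL_mult: "A \<in> SL k \<Longrightarrow> B \<in> SL k \<Longrightarrow> A * B \<in> SL k"
  by (auto simp: SL_def det_mult)

lemma SL_cancel_vec:
  assumes A: "A \<in> SL k" and v: "v \<in> carrier_vec k" and w: "w \<in> carrier_vec k"
    and eq: "A *\<^sub>v v = A *\<^sub>v w"
  shows "v = w"
proof -
  obtain B where B: "B \<in> SL k" "B * A = 1\<^sub>m k"
    using SL_inverse[OF A] .
  have "B *\<^sub>v (A *\<^sub>v u) = u" if "u \<in> carrier_vec k" for u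
    using assoc_mult_mat_vec[OF SL_carrier[OF B(1)] SL_carrier[OF A] that] B(2) that by simp
  then show ?thesis
    using eq v w by metis
qed

lemma mult_mat_of_cols:
  assumes "A \<in> carrier_mat m k" "set vs \<subseteq> carrier_vec k"
  shows "A * mat_of_cols k vs = mat_of_cols m (map ((*\<^sub>v) A) vs)"
proof (rule eq_matI)
  fix a b assume ab: "a < dim_row (mat_of_cols m (map ((*\<^sub>v) A) vs))"
    "b < dim_col (mat_of_cols m (map ((*\<^sub>v) A) vs))"
  then have "vs ! b \<in> carrier_vec k"
    using assms(2) by auto
  then show "(A * mat_of_cols k vs) $$ (a, b) = mat_of_cols m (map ((*\<^sub>v) A) vs) $$ (a, b)"
    using ab assms(1) by (simp add: mat_of_cols_index)
qed (use assms in auto)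

lemma det_SL_mult_cols:
  assumes "A \<in> SL k" "set vs \<subseteq> carrier_vec k" "length vs = k"
  shows "det (mat_of_cols k (map ((*\<^sub>v) A) vs)) = det (mat_of_cols k vs)"
proof -
  have c: "mat_of_cols k vs \<in> carrier_mat k k"
    using assms(3) by auto
  show ?thesis
    using det_mult[OF SL_carrier[OF assms(1)] c] SL_det[OF assms(1)]
      mult_mat_of_cols[OF SL_carrier[OF assms(1)] assms(2)] by simp
qed

lemma det_upper_triangular_diag:
  assumes "A \<in> carrier_mat n n" "upper_triangular A" "\<And>a. a < n \<Longrightarrow> A $$ (a, a) = d a"
  shows "det A = (\<Prod>a<n. d a)"
proof -
  have "det A = prod_list (diag_mat A)"
    by (rule det_upper_triangular[OF assms(2,1)])
  also have "\<dots> = (\<Prod>a<n. d a)"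
    using assms(1,3) by (simp add: prod_list_diag_prod atLeast0LessThan)
  finally show ?thesis .
qed

text \<open>The vectors form an integer matrix of determinant 1, which the adjugate inverts. This
  serves to identify two transfer matrices that act alike on \<open>k\<close> suitable
  columns.\<close>

lemma mat_eqI_SL_cols:
  fixes A B :: "int mat"
  assumes A: "A \<in> carrier_mat k k" and B: "B \<in> carrier_mat k k"
    and vs: "length vs = k" "mat_of_cols k vs \<in> SL k" "set vs \<subseteq> carrier_vec k"
    and eq: "\<And>v. v \<in> set vs \<Longrightarrow> A *\<^sub>v v = B *\<^sub>v v"
  shows "A = B"
proof -
  let ?V = "mat_of_cols k vs"
  have V: "?V \<in> carrier_mat k k" "det ?V = 1"
    using vs(2) by (auto simp: SL_def)
  have "A * ?V = B * ?V"
    unfolding mult_mat_of_cols[OF A vs(3)] mult_mat_of_cols[OF B vs(3)]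
    using eq by (simp cong: map_cong)
  then have "A * (?V * adj_mat ?V) = B * (?V * adj_mat ?V)"
    using assoc_mult_mat[OF A V(1) adj_mat(1)[OF V(1)]] assoc_mult_mat[OF B V(1) adj_mat(1)[OF V(1)]]
    by simp
  moreover have "?V * adj_mat ?V = 1\<^sub>m k"
    using adj_mat(2)[OF V(1)] V(2) by auto
  ultimately show ?thesis
    using A B by simp
qed

section \<open>Transfer between row windows\<close>

text \<open>These segments are the columns of the adjacent submatrices; the passage from row
  \<open>i\<close> to row \<open>i + 1\<close> will be one matrix acting on all of them.\<close>

definition row_window :: "nat \<Rightarrow> (int \<Rightarrow> int \<Rightarrow> int) \<Rightarrow> int \<Rightarrow> int \<Rightarrow> int vec" where
  "row_window k m i j = vec k (\<lambda>a. m (i + int a) j)"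

lemma row_window_carrier [simp]: "row_window k m i j \<in> carrier_vec k"
  by (simp add: row_window_def)

lemma adj_submatrix_cols:
  "adj_submatrix k m i j = mat_of_cols k (map (\<lambda>b. row_window k m i (j + int b)) [0..<k])"
  by (rule eq_matI) (auto simp: adj_submatrix_def row_window_def mat_of_cols_index)

text \<open>Each component of the equation for \<open>B\<close> is a linear relation among
  \<open>k + 1\<close> consecutive rows. It holds on \<open>k\<close> adjacent columns, so
  \<open>det_zero_last_column\<close> carries it to the next one.\<close>

lemma row_window_extend:
  assumes P: "det (adj_submatrix k m i j) \<noteq> 0" and M: "det (adj_submatrix (k + 1) m i j) = 0"
    and B: "B \<in> carrier_mat k k"
    and eq: "\<And>b. b < k \<Longrightarrow> row_window k m (i + 1) (j + int b) = B *\<^sub>v row_window k m i (j + int b)"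
  shows "row_window k m (i + 1) (j + int k) = B *\<^sub>v row_window k m i (j + int k)"
proof (rule eq_vecI)
  fix r assume "r < dim_vec (B *\<^sub>v row_window k m i (j + int k))"
  then have r: "r < k"
    using B by simp
  \<comment> \<open>The coefficients of this relation: row \<open>r\<close> of \<open>B\<close>
    minus the unit vector at \<open>Suc r\<close>. For \<open>r = k - 1\<close> the unit sits at
    index \<open>k\<close>, just beyond the columns of \<open>B\<close>.\<close>
  define x where "x a = (if a < k then B $$ (r, a) else 0) - (if a = Suc r then 1 else 0)" for a
  have x: "(\<Sum>a<Suc k. x a * m (i + int a) c)
      = (B *\<^sub>v row_window k m i c) $ r - row_window k m (i + 1) c $ r" for c
  proof -
    have "(\<Sum>a<Suc k. x a * m (i + int a) c)
        = (\<Sum>a<Suc k. (if a < k then B $$ (r, a) else 0) * m (i + int a) c)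
          - (\<Sum>a<Suc k. if a = Suc r then m (i + int a) c else 0)"
      unfolding x_def left_diff_distrib sum_subtractf
      by (intro arg_cong2[of _ _ _ _ "(-)"] sum.cong) auto
    also have "(\<Sum>a<Suc k. if a = Suc r then m (i + int a) c else 0) = row_window k m (i + 1) c $ r"
      using r by (subst sum.delta) (auto simp: row_window_def algebra_simps)
    also have "(\<Sum>a<Suc k. (if a < k then B $$ (r, a) else 0) * m (i + int a) c)
        = (B *\<^sub>v row_window k m i c) $ r"
      using r B by (simp add: row_window_def mult_mat_vec_def scalar_prod_def atLeast0LessThan)
    finally show ?thesis .
  qed
  have "(\<Sum>a<Suc k. x a * m (i + int a) (j + int k)) = 0"
    by (rule det_zero_last_column[where g = "\<lambda>a b. m (i + int a) (j + int b)"])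
      (use P M eq in \<open>simp_all add: x adj_submatrix_def del: sum.lessThan_Suc\<close>)
  then show "row_window k m (i + 1) (j + int k) $ r = (B *\<^sub>v row_window k m i (j + int k)) $ r"
    by (simp add: x del: sum.lessThan_Suc)
qed (use B in \<open>simp add: row_window_def\<close>)

text \<open>The first \<open>k\<close> columns force \<open>B\<close> to be the quotient of the two
  adjacent submatrices at \<open>j0\<close>, of determinant 1; the vanishing larger determinants
  propagate it to the right. Assumptions concern columns from \<open>j0\<close> on only, so friezes
  and full tilings are both covered.\<close>

lemma row_transfer:
  assumes D: "\<And>j. j0 \<le> j \<Longrightarrow> det (adj_submatrix k m i j) = 1"
    and D': "det (adj_submatrix k m (i + 1) j0) = 1"
    and T: "\<And>j. j0 \<le> j \<Longrightarrow> det (adj_submatrix (k + 1) m i j) = 0"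
  obtains B where "B \<in> SL k"
    "\<And>j. j0 \<le> j \<Longrightarrow> row_window k m (i + 1) j = B *\<^sub>v row_window k m i j"
proof -
  let ?W = "adj_submatrix k m i j0" and ?W' = "adj_submatrix k m (i + 1) j0"
  have c: "?W \<in> carrier_mat k k" "?W' \<in> carrier_mat k k"
    by (auto simp: adj_submatrix_def)
  then have W: "?W \<in> SL k" "?W' \<in> SL k"
    using D D' by (auto simp: SL_def)
  obtain V where V: "V \<in> SL k" "V * ?W = 1\<^sub>m k"
    using SL_inverse[OF W(1)] .
  define B where "B = ?W' * V"
  have B: "B \<in> SL k"
    unfolding B_def by (rule SL_mult[OF W(2) V(1)])
  have BW: "?W' = B * ?W"
    using assoc_mult_mat[OF c(2) SL_carrier[OF V(1)] c(1)] V(2) c(2) by (simp add: B_def)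
  have first: "row_window k m (i + 1) (j0 + int b) = B *\<^sub>v row_window k m i (j0 + int b)"
    if b: "b < k" for b
  proof -
    have "col ?W' b = B *\<^sub>v col ?W b"
      using b c SL_carrier[OF B] by (subst BW) (auto simp: mult_mat_vec_def)
    moreover have "col (adj_submatrix k m i' j0) b = row_window k m i' (j0 + int b)" for i'
      using b by (auto simp: adj_submatrix_def row_window_def)
    ultimately show ?thesis
      by simp
  qed
  \<comment> \<open>Column \<open>j0 + p + k\<close> is reached from the \<open>k\<close> columns
    directly before it, hence the strong induction.\<close>
  have all: "row_window k m (i + 1) (j0 + int n) = B *\<^sub>v row_window k m i (j0 + int n)" for n
  proof (induction n rule: less_induct)
    case (less n)
    show ?case
    proof (cases "n < k")
      case False
      then obtain p where p: "n = p + k"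
        by (metis add.commute le_Suc_ex not_less)
      have "row_window k m (i + 1) ((j0 + int p) + int k) = B *\<^sub>v row_window k m i ((j0 + int p) + int k)"
        by (rule row_window_extend)
          (use D[of "j0 + int p"] T[of "j0 + int p"] SL_carrier[OF B] less.IH[of "p + _"] p in \<open>auto simp: add.assoc\<close>)
      then show ?thesis
        by (simp add: p add.assoc)
    qed (rule first)
  qed
  show ?thesis
  proof (rule that[OF B])
    fix j assume "j0 \<le> j"
    then have "j = j0 + int (nat (j - j0))"
      by simp
    then show "row_window k m (i + 1) j = B *\<^sub>v row_window k m i j"
      using all by metis
  qed
qed

text \<open>Descend along a column \<open>j\<close>: windows with small \<open>i\<close> lie in the
  common part, and each transfer matrix is already determined by columns far enough to the
  right.\<close>

lemma tame_SL_tiling_unique: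
  assumes k: "k > 0" and m: "SL_tiling k m" "tame k m" and m': "SL_tiling k m'" "tame k m'"
    and eq: "\<And>i j. i \<le> j \<Longrightarrow> m i j = m' i j"
  shows "m = m'"
proof (intro ext)
  fix i j
  have win: "row_window k m i j = row_window k m' i j" if "i + int k \<le> j + 1" for i j
    using that eq by (auto simp: row_window_def)
  have "row_window k m i j = row_window k m' i j"
  proof (cases "i + int k \<le> j + 1")
    case False
    then have "j - int k \<le> i"
      by simp
    then show ?thesis
    proof (induction i rule: int_ge_induct)
      case base
      then show ?case
        by (simp add: win)
    next
      case (step i)
      \<comment> \<open>The transfer must reach column \<open>j\<close> and also column
        \<open>i + k\<close>, the first whose windows at rows \<open>i\<close> and
        \<open>i + 1\<close> both lie in the common part. The \<open>k\<close> columns from there on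
        identify \<open>B\<close> with \<open>B'\<close>.\<close>
      let ?j0 = "min j (i + int k)"
      obtain B where B: "B \<in> SL k"
        "\<And>j. ?j0 \<le> j \<Longrightarrow> row_window k m (i + 1) j = B *\<^sub>v row_window k m i j"
        using row_transfer[of ?j0 k m i] m by (auto simp: SL_tiling_def tame_def)
      obtain B' where B': "B' \<in> SL k"
        "\<And>j. ?j0 \<le> j \<Longrightarrow> row_window k m' (i + 1) j = B' *\<^sub>v row_window k m' i j"
        using row_transfer[of ?j0 k m' i] m' by (auto simp: SL_tiling_def tame_def)
      have "B = B'"
      proof (rule mat_eqI_SL_cols[OF SL_carrier[OF B(1)] SL_carrier[OF B'(1)]])
        let ?vs = "map (\<lambda>b. row_window k m i (i + int k + int b)) [0..<k]"
        show "mat_of_cols k ?vs \<in> SL k"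
          using m(1) by (auto simp: SL_tiling_def SL_def simp flip: adj_submatrix_cols)
            (simp add: adj_submatrix_def)
        fix v assume "v \<in> set ?vs"
        then obtain b where v: "v = row_window k m i (i + int k + int b)"
          by auto
        show "B *\<^sub>v v = B' *\<^sub>v v"
          using B(2)[of "i + int k + int b"] B'(2)[of "i + int k + int b"]
            win[of i "i + int k + int b"] win[of "i + 1" "i + int k + int b"] v by simp
      qed auto
      then show ?case
        using B(2)[of j] B'(2)[of j] step.IH by simp
    qed
  qed (rule win)
  then have "row_window k m i j $ 0 = row_window k m' i j $ 0"
    by simp
  then show "m i j = m' i j"
    using k by (simp add: row_window_def)
qed

section \<open>The tiling of a path\<close>

text \<open>Rows \<open>i - k + 1\<close> to \<open>i\<close> are chosen so that the zeros fall
  below the diagonal and the ones on it, except for the last diagonal entry, which is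
  \<open>m i j\<close>. Thus the determinant formula of a path tiling, applied to windows, returns
  the entry itself.\<close>

lemma det_frieze_window:
  assumes k: "k > 0" and zero: "\<And>i j. i \<le> j \<Longrightarrow> j \<le> i + int k - 2 \<Longrightarrow> m i j = 0"
    and one: "\<And>i. m i (i + int k - 1) = 1"
  shows "det (mat_of_cols k (map (\<lambda>l. row_window k m (i - int k + 1) (i + int l)) [0..<k - 1]
           @ [row_window k m (i - int k + 1) j])) = m i j" (is "det ?A = _")
proof -
  have idx: "?A $$ (a, b) = m (i - int k + 1 + int a) (if b < k - 1 then i + int b else j)"
    if "a < k" "b < k" for a b
    using that k by (auto simp: mat_of_cols_index nth_append row_window_def)
  have "det ?A = (\<Prod>a<k. if a < k - 1 then 1 else m i j)"
  proof (rule det_upper_triangular_diag)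
    show "?A \<in> carrier_mat k k"
      using k by (intro carrier_matI) auto
    show "upper_triangular ?A"
    proof (rule upper_triangularI)
      fix a b assume "b < a" "a < dim_row ?A"
      then show "?A $$ (a, b) = 0"
        by (subst idx) (auto intro!: zero)
    qed
    fix a assume "a < k"
    then show "?A $$ (a, a) = (if a < k - 1 then 1 else m i j)"
    proof (cases "a < k - 1")
      case True
      then show ?thesis
        using one[of "i - int k + 1 + int a"] \<open>a < k\<close> by (subst idx) (auto simp: algebra_simps)
    next
      case False
      then have "i - int k + 1 + int a = i"
        using \<open>a < k\<close> by linarith
      then show ?thesis
        by (simp only: idx[OF \<open>a < k\<close> \<open>a < k\<close>] False if_False)
    qed
  qed
  also have "\<dots> = m i j"
    using k by (cases k) auto
  finally show ?thesis .
qed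

text \<open>The generalized cross product of \<open>k - 1\<close> consecutive path vectors, that is,
  the linear form sending a vector to its determinant with them. The zero column is a placeholder
  that cofactors along the last column do not see.\<close>

definition path_covector :: "nat \<Rightarrow> (int \<Rightarrow> int vec) \<Rightarrow> int \<Rightarrow> int vec" where
  "path_covector k \<gamma> i = vec k (\<lambda>r. cofactor
     (mat_of_cols k (map (\<lambda>l. \<gamma> (i + int l)) [0..<k - 1] @ [0\<^sub>v k])) r (k - 1))"

text \<open>Applied to \<open>\<gamma> j\<close>, this matrix will give the window of the path
  tiling in column \<open>j\<close> starting at row \<open>i\<close>.\<close>

definition covector_mat :: "nat \<Rightarrow> (int \<Rightarrow> int vec) \<Rightarrow> int \<Rightarrow> int mat" where
  "covector_mat k \<gamma> i = mat k k (\<lambda>(a, r). path_covector k \<gamma> (i + int a) $ r)"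

context
  fixes k :: nat and \<gamma> :: "int \<Rightarrow> int vec"
  assumes k: "k \<ge> 2" and \<gamma>: "\<gamma> \<in> paths k"
begin

lemma path_carrier: "\<gamma> i \<in> carrier_vec k"
  using \<gamma> by (simp add: paths_def)

lemma path_window: "mat_of_cols k (map (\<lambda>l. \<gamma> (i + int l)) [0..<k]) \<in> SL k"
  using \<gamma> by (simp add: paths_def)

lemma path_tiling_covector: "path_tiling k \<gamma> i j = (\<Sum>r<k. path_covector k \<gamma> i $ r * \<gamma> j $ r)"
proof -
  let ?us = "map (\<lambda>l. \<gamma> (i + int l)) [0..<k - 1]"
  let ?A = "mat_of_cols k (?us @ [\<gamma> j])" and ?Z = "mat_of_cols k (?us @ [0\<^sub>v k])"
  have A: "?A \<in> carrier_mat k k"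
    using k by (intro carrier_matI) auto
  have "path_tiling k \<gamma> i j = (\<Sum>r<k. ?A $$ (r, k - 1) * cofactor ?A r (k - 1))"
    unfolding path_tiling_def by (rule laplace_expansion_column[OF A]) (use k in simp)
  also have "\<dots> = (\<Sum>r<k. path_covector k \<gamma> i $ r * \<gamma> j $ r)"
  proof (rule sum.cong[OF refl])
    fix r assume r: "r \<in> {..<k}"
    have "mat_delete ?A r (k - 1) = mat_delete ?Z r (k - 1)"
      using k by (intro eq_matI) (auto simp: mat_delete_def mat_of_cols_def nth_append)
    then have "cofactor ?A r (k - 1) = path_covector k \<gamma> i $ r"
      using r by (simp add: cofactor_def path_covector_def)
    moreover have "?A $$ (r, k - 1) = \<gamma> j $ r"
      using r k by (auto simp: mat_of_cols_index nth_append)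
    ultimately show "?A $$ (r, k - 1) * cofactor ?A r (k - 1) = path_covector k \<gamma> i $ r * \<gamma> j $ r"
      by simp
  qed
  finally show ?thesis .
qed

lemma covector_mat_carrier: "covector_mat k \<gamma> i \<in> carrier_mat k k"
  by (simp add: covector_mat_def)

lemma row_window_path_tiling:
  "row_window k (path_tiling k \<gamma>) i j = covector_mat k \<gamma> i *\<^sub>v \<gamma> j"
  using path_carrier[of j]
  by (intro eq_vecI)
    (auto simp: row_window_def covector_mat_def path_tiling_covector mult_mat_vec_def
      scalar_prod_def atLeast0LessThan intro!: sum.cong)

lemma adj_submatrix_path_tiling:
  "adj_submatrix k (path_tiling k \<gamma>) i j
     = covector_mat k \<gamma> i * mat_of_cols k (map (\<lambda>l. \<gamma> (j + int l)) [0..<k])"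
  by (subst mult_mat_of_cols[OF covector_mat_carrier])
    (auto simp: adj_submatrix_cols row_window_path_tiling path_carrier comp_def)

lemma path_tiling_zero:
  assumes "i \<le> j" "j \<le> i + int k - 2"
  shows "path_tiling k \<gamma> i j = 0"
proof -
  let ?A = "mat_of_cols k (map (\<lambda>l. \<gamma> (i + int l)) [0..<k - 1] @ [\<gamma> j])"
  have "nat (j - i) < k - 1"
    using assms by linarith
  then have "col ?A (nat (j - i)) = col ?A (k - 1)"
    using k assms(1) path_carrier by (subst (1 2) col_mat_of_cols) (auto simp: nth_append)
  then show ?thesis
    unfolding path_tiling_def using k assms
    by (intro det_identical_columns[of ?A k "nat (j - i)" "k - 1"]) (auto intro!: carrier_matI)
qed

lemma path_tiling_one: "path_tiling k \<gamma> i (i + int k - 1) = 1"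
proof -
  have "map (\<lambda>l. \<gamma> (i + int l)) [0..<k - 1] @ [\<gamma> (i + int k - 1)] = map (\<lambda>l. \<gamma> (i + int l)) [0..<k]"
    using k by (cases k) (auto simp: algebra_simps)
  then show ?thesis
    using SL_det[OF path_window[of i]] by (simp add: path_tiling_def)
qed

text \<open>The determinant is read off from the product with one window of the path, which has
  determinant 1 itself.\<close>

lemma covector_mat_SL: "covector_mat k \<gamma> i \<in> SL k"
proof -
  let ?m = "path_tiling k \<gamma>"
  \<comment> \<open>With columns starting at \<open>j\<close>, the product is a submatrix of the
    shape in \<open>det_frieze_window\<close>, whose last diagonal entry lies in the row of
    ones.\<close>
  define j where "j = i + int k - 1"
  have i: "i = j - int k + 1"
    by (simp add: j_def)
  have "map (\<lambda>l. row_window k ?m i (j + int l)) [0..<k - 1] @ [row_window k ?m i (j + int k - 1)]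
      = map (\<lambda>l. row_window k ?m i (j + int l)) [0..<k]"
    using k by (cases k) (auto simp: algebra_simps)
  moreover have "det (mat_of_cols k (map (\<lambda>l. row_window k ?m (j - int k + 1) (j + int l)) [0..<k - 1]
      @ [row_window k ?m (j - int k + 1) (j + int k - 1)])) = ?m j (j + int k - 1)"
    by (rule det_frieze_window) (use k path_tiling_zero path_tiling_one in auto)
  ultimately have "det (adj_submatrix k ?m i j) = 1"
    using path_tiling_one[of j] by (simp only: adj_submatrix_cols i)
  then have "det (covector_mat k \<gamma> i) * 1 = 1"
    using det_mult[OF covector_mat_carrier SL_carrier[OF path_window]] SL_det[OF path_window[of j]]
    by (simp add: adj_submatrix_path_tiling)
  then show ?thesis
    by (simp add: SL_def covector_mat_carrier)
qed

lemma SL_tiling_path_tiling: "SL_tiling k (path_tiling k \<gamma>)"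
  unfolding SL_tiling_def
  using SL_det[OF SL_mult[OF covector_mat_SL path_window]] by (simp add: adj_submatrix_path_tiling)

text \<open>A factorisation through \<open>k\<close> dimensions, padded by zeros to square matrices of size \<open>k + 1\<close>.\<close>

lemma tame_path_tiling: "tame k (path_tiling k \<gamma>)"
  unfolding tame_def
proof (intro allI)
  fix i j
  define N where "N = mat (k + 1) (k + 1)
    (\<lambda>(a, r). if r < k then path_covector k \<gamma> (i + int a) $ r else 0)"
  define G where "G = mat (k + 1) (k + 1) (\<lambda>(r, b). \<gamma> (j + int b) $ r)"
  have c: "N \<in> carrier_mat (k + 1) (k + 1)" "G \<in> carrier_mat (k + 1) (k + 1)"
    by (auto simp: N_def G_def)
  have "adj_submatrix (k + 1) (path_tiling k \<gamma>) i j = N * G"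
    by (rule eq_matI) (auto simp: adj_submatrix_def N_def G_def path_tiling_covector
        scalar_prod_def atLeast0LessThan)
  moreover have "det N = (\<Sum>a<k + 1. N $$ (a, k) * cofactor N a k)"
    by (rule laplace_expansion_column[OF c(1)]) simp
  then have "det N = 0"
    by (simp add: N_def)
  ultimately show "det (adj_submatrix (k + 1) (path_tiling k \<gamma>) i j) = 0"
    using det_mult[OF c] by simp
qed

lemma path_tiling_frieze: "path_tiling k \<gamma> \<in> friezes k"
  using SL_tiling_path_tiling tame_path_tiling path_tiling_zero path_tiling_one
  by (simp add: friezes_def SL_tiling_def tame_def)

text \<open>The path tiling witnesses existence for the definite description, and
  \<open>tame_SL_tiling_unique\<close> gives uniqueness.\<close>

lemma frieze_tiling_eqI:
  assumes "\<And>i j. i \<le> j \<Longrightarrow> path_tiling k \<gamma> i j = f i j"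
  shows "frieze_tiling k f = path_tiling k \<gamma>"
  unfolding frieze_tiling_def
proof (rule the_equality)
  fix m assume "SL_tiling k m \<and> tame k m \<and> (\<forall>i j. i \<le> j \<longrightarrow> m i j = f i j)"
  then show "m = path_tiling k \<gamma>"
    using k assms SL_tiling_path_tiling tame_path_tiling by (intro tame_SL_tiling_unique) auto
qed (use assms SL_tiling_path_tiling tame_path_tiling in auto)

end

section \<open>Paths modulo the special linear group\<close>

lemma path_tiling_act:
  assumes "k > 0" "\<gamma> \<in> paths k" "A \<in> SL k"
  shows "path_tiling k (path_act A \<gamma>) = path_tiling k \<gamma>"
proof (intro ext)
  fix i j
  show "path_tiling k (path_act A \<gamma>) i j = path_tiling k \<gamma> i j"
    using det_SL_mult_cols[OF assms(3), of "map (\<lambda>l. \<gamma> (i + int l)) [0..<k - 1] @ [\<gamma> j]"] assms(1,2)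
    by (auto simp: path_tiling_def path_act_def comp_def paths_def)
qed

text \<open>\<open>?N\<close> applied to \<open>\<gamma> j\<close> and \<open>?M\<close> applied to
  \<open>\<delta> j\<close> give the same window of the common tiling, so the inverse of
  \<open>?M\<close> times \<open>?N\<close> carries one path to the other.\<close>

lemma path_tiling_inj:
  assumes k: "k \<ge> 2" and \<gamma>: "\<gamma> \<in> paths k" and \<delta>: "\<delta> \<in> paths k"
    and eq: "path_tiling k \<gamma> = path_tiling k \<delta>"
  shows "(\<gamma>, \<delta>) \<in> path_rel k"
proof -
  let ?N = "covector_mat k \<gamma> 0" and ?M = "covector_mat k \<delta> 0"
  have N: "?N \<in> SL k" and M: "?M \<in> SL k"
    by (rule covector_mat_SL[OF k \<gamma>], rule covector_mat_SL[OF k \<delta>])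
  obtain V where V: "V \<in> SL k" "V * ?M = 1\<^sub>m k"
    using SL_inverse[OF M] .
  have "\<delta> j = (V * ?N) *\<^sub>v \<gamma> j" for j
  proof -
    have c: "\<gamma> j \<in> carrier_vec k" "\<delta> j \<in> carrier_vec k"
      by (rule path_carrier[OF k \<gamma>], rule path_carrier[OF k \<delta>])
    have "\<delta> j = (V * ?M) *\<^sub>v \<delta> j"
      using V(2) c(2) by simp
    also have "\<dots> = V *\<^sub>v (?M *\<^sub>v \<delta> j)"
      by (rule assoc_mult_mat_vec[OF SL_carrier[OF V(1)] SL_carrier[OF M] c(2)])
    also have "?M *\<^sub>v \<delta> j = ?N *\<^sub>v \<gamma> j"
      using row_window_path_tiling[OF k \<gamma>, of 0 j] row_window_path_tiling[OF k \<delta>, of 0 j] eq by simp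
    also have "V *\<^sub>v (?N *\<^sub>v \<gamma> j) = (V * ?N) *\<^sub>v \<gamma> j"
      by (rule assoc_mult_mat_vec[OF SL_carrier[OF V(1)] SL_carrier[OF N] c(1), symmetric])
    finally show ?thesis .
  qed
  then have "\<delta> = path_act (V * ?N) \<gamma>"
    by (auto simp: path_act_def)
  then show ?thesis
    using \<gamma> \<delta> SL_mult[OF V(1) N] by (auto simp: path_rel_def)
qed

section \<open>The path of a frieze\<close>

lemma frieze_path:
  assumes k: "k \<ge> 2" and f: "f \<in> friezes k"
  obtains \<gamma> where "\<gamma> \<in> paths k" "\<And>i j. i \<le> j \<Longrightarrow> path_tiling k \<gamma> i j = f i j"
proof -
  have W: "adj_submatrix k f i j \<in> SL k" if "i + int k - 1 \<le> j" for i j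
    using f that by (auto simp: friezes_def SL_def adj_submatrix_def)
  have transfer: "\<exists>B \<in> SL k. \<forall>j \<ge> i + int k. row_window k f (i + 1) j = B *\<^sub>v row_window k f i j" for i
    by (rule row_transfer[of "i + int k" k f i]) (use f in \<open>auto simp: friezes_def\<close>)
  \<comment> \<open>\<open>\<gamma> j\<close> is the coordinate vector of column \<open>j\<close> in
    the basis of columns \<open>0\<close> to \<open>k - 1\<close>, the adjugate being the inverse.
    Both are read from row \<open>p\<close> on, the largest start at which they lie inside the
    frieze.\<close>
  define \<gamma> where "\<gamma> j = (let p = min 0 j - int k + 1
     in adj_mat (adj_submatrix k f p 0) *\<^sub>v row_window k f p j)" for j
  have adj: "adj_mat (adj_submatrix k f p 0) \<in> carrier_mat k k" for p
    by (rule adj_mat(1)) (simp add: adj_submatrix_def)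
  have \<gamma>c: "\<gamma> j \<in> carrier_vec k" for j
    unfolding \<gamma>_def Let_def by (rule mult_mat_vec_carrier[OF adj row_window_carrier])
  \<comment> \<open>The coordinates do not depend on the start row: one transfer matrix moves the
    basis columns and column \<open>j\<close> alike, and it can be cancelled.\<close>
  have low: "adj_submatrix k f i 0 *\<^sub>v \<gamma> j = row_window k f i j" if "i \<le> min 0 j - int k + 1" for i j
    using that
  proof (induction i rule: int_le_induct)
    case base
    let ?p = "min 0 j - int k + 1"
    have "adj_submatrix k f ?p 0 * adj_mat (adj_submatrix k f ?p 0) = 1\<^sub>m k"
      using adj_mat(2)[OF SL_carrier[OF W[of ?p 0]]] SL_det[OF W[of ?p 0]] by auto
    then show ?case
      using assoc_mult_mat_vec[OF SL_carrier[OF W[of ?p 0]] adj[of ?p] row_window_carrier[of k f ?p j]]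
      by (simp add: \<gamma>_def Let_def)
  next
    case (step i)
    obtain B where B: "B \<in> SL k"
      "\<And>j. j \<ge> i - 1 + int k \<Longrightarrow> row_window k f i j = B *\<^sub>v row_window k f (i - 1) j"
      using transfer[of "i - 1"] by auto
    have c: "adj_submatrix k f (i - 1) 0 \<in> carrier_mat k k"
      by (simp add: adj_submatrix_def)
    have "B * adj_submatrix k f (i - 1) 0 = adj_submatrix k f i 0"
      using step.hyps unfolding adj_submatrix_cols
      by (subst mult_mat_of_cols[OF SL_carrier[OF B(1)]]) (auto simp: B(2) comp_def)
    then have "B *\<^sub>v (adj_submatrix k f (i - 1) 0 *\<^sub>v \<gamma> j) = adj_submatrix k f i 0 *\<^sub>v \<gamma> j"
      using assoc_mult_mat_vec[OF SL_carrier[OF B(1)] c \<gamma>c] by simp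
    also have "\<dots> = B *\<^sub>v row_window k f (i - 1) j"
      using step B(2)[of j] by simp
    finally show ?case
      using SL_cancel_vec[OF B(1) mult_mat_vec_carrier[OF c \<gamma>c]] by simp
  qed
  \<comment> \<open>For small \<open>i\<close> the basis columns themselves form \<open>T\<close>;
    further down, \<open>T\<close> is multiplied by transfer matrices. The bound on \<open>j\<close>
    says that the window lies inside the frieze.\<close>
  have ex: "\<exists>T \<in> SL k. \<forall>j \<ge> i + int k - 1. T *\<^sub>v \<gamma> j = row_window k f i j" for i
  proof (cases "i \<le> 1 - int k")
    case True
    then show ?thesis
      using W[of i 0] low[of i] by (intro bexI[of _ "adj_submatrix k f i 0"]) auto
  next
    case False
    then have "1 - int k \<le> i"
      by simp
    then show ?thesis
    proof (induction i rule: int_ge_induct)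
      case base
      then show ?case
        using W[of "1 - int k" 0] low[of "1 - int k"]
        by (intro bexI[of _ "adj_submatrix k f (1 - int k) 0"]) auto
    next
      case (step i)
      obtain T where T: "T \<in> SL k" "\<And>j. j \<ge> i + int k - 1 \<Longrightarrow> T *\<^sub>v \<gamma> j = row_window k f i j"
        using step.IH by auto
      obtain B where B: "B \<in> SL k"
        "\<And>j. j \<ge> i + int k \<Longrightarrow> row_window k f (i + 1) j = B *\<^sub>v row_window k f i j"
        using transfer[of i] by auto
      have "(B * T) *\<^sub>v \<gamma> j = row_window k f (i + 1) j" if "j \<ge> i + int k" for j
        using assoc_mult_mat_vec[OF SL_carrier[OF B(1)] SL_carrier[OF T(1)] \<gamma>c, of j] T(2) B(2) that by simp
      then show ?case
        using SL_mult[OF B(1) T(1)] by (intro bexI[of _ "B * T"]) auto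
    qed
  qed
  show ?thesis
  proof (rule that)
    show "\<gamma> \<in> paths k"
      unfolding paths_def
    proof (intro CollectI conjI allI)
      fix i
      \<comment> \<open>Windows starting at \<open>?p\<close> end at row \<open>i\<close>, so
        \<open>T\<close> is available for all columns from \<open>i\<close> on.\<close>
      let ?p = "i - int k + 1" and ?vs = "map (\<lambda>l. \<gamma> (i + int l)) [0..<k]"
      obtain T where T: "T \<in> SL k" "\<And>j. j \<ge> ?p + int k - 1 \<Longrightarrow> T *\<^sub>v \<gamma> j = row_window k f ?p j"
        using ex[of ?p] by auto
      have vs: "map ((*\<^sub>v) T) ?vs = map (\<lambda>l. row_window k f ?p (i + int l)) [0..<k]"
        using T(2) by (simp add: comp_def)
      have "det (mat_of_cols k ?vs) = det (mat_of_cols k (map ((*\<^sub>v) T) ?vs))"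
        by (rule det_SL_mult_cols[OF T(1), symmetric]) (use \<gamma>c in auto)
      also have "\<dots> = det (adj_submatrix k f ?p i)"
        by (simp only: vs adj_submatrix_cols)
      also have "\<dots> = 1"
        using SL_det[OF W[of ?p i]] by simp
      finally show "mat_of_cols k ?vs \<in> SL k"
        by (auto simp: SL_def intro!: carrier_matI)
    qed (rule \<gamma>c)
    fix i j :: int assume ij: "i \<le> j"
    let ?p = "i - int k + 1" and ?vs = "map (\<lambda>l. \<gamma> (i + int l)) [0..<k - 1] @ [\<gamma> j]"
    obtain T where T: "T \<in> SL k" "\<And>j. j \<ge> ?p + int k - 1 \<Longrightarrow> T *\<^sub>v \<gamma> j = row_window k f ?p j"
      using ex[of ?p] by auto
    have vs: "map ((*\<^sub>v) T) ?vs
        = map (\<lambda>l. row_window k f ?p (i + int l)) [0..<k - 1] @ [row_window k f ?p j]"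
      using T(2) ij by (simp add: comp_def)
    have "path_tiling k \<gamma> i j = det (mat_of_cols k (map ((*\<^sub>v) T) ?vs))"
      unfolding path_tiling_def
      by (rule det_SL_mult_cols[OF T(1), symmetric]) (use \<gamma>c k in auto)
    also have "\<dots> = det (mat_of_cols k
        (map (\<lambda>l. row_window k f ?p (i + int l)) [0..<k - 1] @ [row_window k f ?p j]))"
      by (simp only: vs)
    \<comment> \<open>The top rows of zeros and ones make this matrix triangular.\<close>
    also have "\<dots> = f i j"
      by (rule det_frieze_window) (use k f in \<open>auto simp: friezes_def\<close>)
    finally show "path_tiling k \<gamma> i j = f i j" .
  qed
qed

section \<open>The image of the map and the bijection\<close>

lemma FR_eq_path_tilings:
  assumes k: "k \<ge> 2"
  shows "FR k = path_tiling k ` paths k"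
proof
  show "FR k \<subseteq> path_tiling k ` paths k"
    unfolding FR_def
  proof
    fix m assume "m \<in> frieze_tiling k ` friezes k"
    then obtain f where f: "f \<in> friezes k" "m = frieze_tiling k f"
      by auto
    obtain \<gamma> where "\<gamma> \<in> paths k" "\<And>i j. i \<le> j \<Longrightarrow> path_tiling k \<gamma> i j = f i j"
      using frieze_path[OF k f(1)] by blast
    then show "m \<in> path_tiling k ` paths k"
      using frieze_tiling_eqI[OF k] f(2) by auto
  qed
  show "path_tiling k ` paths k \<subseteq> FR k"
    unfolding FR_def
  proof
    fix m assume "m \<in> path_tiling k ` paths k"
    then obtain \<gamma> where \<gamma>: "\<gamma> \<in> paths k" "m = path_tiling k \<gamma>"
      by auto
    \<comment> \<open>A path tiling is its own frieze: its part \<open>j \<ge> i\<close> satisfies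
      the frieze conditions and extends back to \<open>m\<close>.\<close>
    then have "m = frieze_tiling k m"
      using frieze_tiling_eqI[OF k, of \<gamma> m] by simp
    then show "m \<in> frieze_tiling k ` friezes k"
      using path_tiling_frieze[OF k \<gamma>(1)] \<gamma>(2) by (intro image_eqI[of _ _ m]) auto
  qed
qed

theorem theorem1p2:
  fixes k :: nat
  assumes "k \<ge> 2"
  shows "path_tiling k respects path_rel k \<and> bij_betw (Phi k) (paths k // path_rel k) (FR k)"
proof
  show resp: "path_tiling k respects path_rel k"
    using assms path_tiling_act by (auto simp: congruent_def path_rel_def)
  have Phi: "Phi k (path_rel k `` {\<gamma>}) = path_tiling k \<gamma>" if "\<gamma> \<in> paths k" for \<gamma>
  proof -
    have "\<gamma> \<in> path_rel k `` {\<gamma>}"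
      by (rule equiv_class_self[OF equiv_path_rel that])
    moreover have "path_tiling k \<delta> = path_tiling k \<gamma>" if "\<delta> \<in> path_rel k `` {\<gamma>}" for \<delta>
      using that congruentD[OF resp, of \<gamma> \<delta>] by simp
    \<comment> \<open>By invariance the values on a class form a singleton, so
      \<open>the_elem\<close> returns the common value.\<close>
    ultimately have "path_tiling k ` (path_rel k `` {\<gamma>}) = {path_tiling k \<gamma>}"
      by blast
    then show ?thesis
      by (simp add: Phi_def)
  qed
  show "bij_betw (Phi k) (paths k // path_rel k) (FR k)"
  proof (rule bij_betw_imageI)
    show "inj_on (Phi k) (paths k // path_rel k)"
    proof (rule inj_onI)
      fix C D assume CD: "C \<in> paths k // path_rel k" "D \<in> paths k // path_rel k" "Phi k C = Phi k D"
      obtain \<gamma> \<delta> where "\<gamma> \<in> paths k" "C = path_rel k `` {\<gamma>}" "\<delta> \<in> paths k" "D = path_rel k `` {\<delta>}"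
        using CD(1,2) by (auto elim!: quotientE)
      then show "C = D"
        using CD(3) Phi path_tiling_inj[OF assms] equiv_class_eq[OF equiv_path_rel] by metis
    qed
    have "Phi k ` (paths k // path_rel k) = (\<lambda>\<gamma>. Phi k (path_rel k `` {\<gamma>})) ` paths k"
      by (auto simp: quotient_def)
    also have "\<dots> = path_tiling k ` paths k"
      using Phi by (rule image_cong[OF refl])
    finally show "Phi k ` (paths k // path_rel k) = FR k"
      by (simp add: FR_eq_path_tilings[OF assms])
  qed
qed

end
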